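(* Let $n\ge 3$, $1\le t<n$, and let $c_1,c_2,\ldots,c_t\in[n]$ be distinct integers such that the sequence $(c_1,\ldots,c_t)$ avoids both patterns $132$ and $231$. If there exist $\alpha\in[n]\setminus\{c_1,\ldots,c_t\}$ and $i,j\in[t]$ with $i<j$ such that $c_i<\alpha<c_j$ or $\alpha<c_i<c_j$, then $|S_{n,(c_1,\ldots,c_t)}(132,231)|=0$; otherwise, $$|S_{n,(c_1,\ldots,c_t)}(132,231)|=2^{\max\{0,\min\{c_1,\ldots,c_t\}-2\}}.$$
   Context: $[n]=\{1,\ldots,n\}$ and $S_n$ is the set of permutations of $[n]$ written as sequences $(\tau(1),\ldots,\tau(n))$. A sequence of distinct integers $\tau=(\tau(1),\ldots,\tau(m))$ contains $\sigma\in S_k$ as a pattern if there are indices $1\le i_1<\cdots<i_k\le m$ such that for all $1\le a<b\le k$, $\tau(i_a)<\tau(i_b)$ if and only if $\sigma(a)<\sigma(b)$; otherwise $\tau$ avoids $\sigma$. $S_{n,(c_1,\ldots,c_t)}(\sigma_1,\ldots,\sigma_m)$ is the set of $\tau\in S_n$ with $(\tau(1),\ldots,\tau(t))=(c_1,\ldots,c_t)$ that avoid all of $\sigma_1,\ldots,\sigma_m$. *)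

theory Defs
  imports "HOL-Combinatorics.Multiset_Permutations"
begin

text \<open>
  Sequences are lists, indexed from 0 by \<open>(!)\<close>, whereas entries are
  counted from 1: the symmetric group on \<open>n\<close> letters, in one-line notation, is
  \<open>permutations_of_set {1..n}\<close>, and the pattern \<open>132\<close> is \<open>[1, 3, 2]\<close>.
\<close>

text \<open>
  The function \<open>f\<close> is the choice of indices \<open>i\<^sub>1 < \<dots> < i\<^sub>k\<close>, where \<open>k\<close> is the length
  of the pattern. The notion is intended for a sequence \<open>\<tau>\<close> with distinct entries
  and a permutation \<open>\<sigma>\<close>.
\<close>

definition contains_pattern :: "'a::linorder list \<Rightarrow> nat list \<Rightarrow> bool" where
  "contains_pattern \<tau> \<sigma> \<longleftrightarrow>
     (\<exists>f :: nat \<Rightarrow> nat.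
        strict_mono_on {..<length \<sigma>} f \<and>
        (\<forall>a<length \<sigma>. f a < length \<tau>) \<and>
        (\<forall>a b. a < b \<and> b < length \<sigma> \<longrightarrow> (\<tau> ! f a < \<tau> ! f b \<longleftrightarrow> \<sigma> ! a < \<sigma> ! b)))"

abbreviation avoids_pattern :: "'a::linorder list \<Rightarrow> nat list \<Rightarrow> bool" where
  "avoids_pattern \<tau> \<sigma> \<equiv> \<not> contains_pattern \<tau> \<sigma>"

definition avoiding_perms_with_prefix :: "nat \<Rightarrow> nat list \<Rightarrow> nat list set \<Rightarrow> nat list set" where
  "avoiding_perms_with_prefix n c \<Sigma> =
     {\<tau> \<in> permutations_of_set {1..n}.
        take (length c) \<tau> = c \<and> (\<forall>\<sigma>\<in>\<Sigma>. avoids_pattern \<tau> \<sigma>)}"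

end

theory Submission
  imports Defs
begin

text \<open>
  Avoiding both \<open>132\<close> and \<open>231\<close> means that no entry has smaller entries on both sides,
  so the sequence is a valley. Outside the degenerate case, the prefix \<open>c\<close> constrains its
  completion \<open>w\<close> only through \<open>m = Min (set c)\<close>: the sequence \<open>m # w\<close> must be a valley.
  The largest entry of \<open>w\<close> sits at one of the two ends of \<open>w\<close>, and only at the right end if
  it exceeds \<open>m\<close>. Removing largest entries one by one thus yields a factor \<open>2\<close> for each
  entry below \<open>m\<close> except the smallest.
\<close>

text \<open>Each forbidden triple is recorded at its left end: \<open>x\<close> is the head,
  \<open>a\<close> the peak, \<open>b\<close> the low entry behind it. This form suits splitting at
  a head or at an append.\<close>

fun valley :: "'a::linorder list \<Rightarrow> bool" where
  "valley [] \<longleftrightarrow> True"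
| "valley (x # xs) \<longleftrightarrow> sorted_wrt (\<lambda>a b. \<not> (x < a \<and> b < a)) xs \<and> valley xs"

text \<open>A forbidden triple straddling the cut has its peak either in \<open>xs\<close>, with
  only its right end in \<open>ys\<close>, or in \<open>ys\<close>, with only its left end in
  \<open>xs\<close>.\<close>

lemma valley_append:
  "valley (xs @ ys) \<longleftrightarrow> valley xs \<and> valley ys \<and>
     (\<forall>y\<in>set ys. sorted_wrt (\<lambda>a b. \<not> (a < b \<and> y < b)) xs) \<and>
     (\<forall>x\<in>set xs. sorted_wrt (\<lambda>a b. \<not> (x < a \<and> b < a)) ys)"
  by (induction xs) (auto simp: sorted_wrt_append)

lemma valley_iff_nth:
  "valley xs \<longleftrightarrow>
     (\<forall>i j k. i < j \<longrightarrow> j < k \<longrightarrow> k < length xs \<longrightarrow> \<not> (xs ! i < xs ! j \<and> xs ! k < xs ! j))"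
proof (induction xs)
  case (Cons x xs)
  let ?P = "\<lambda>xs i j k. i < j \<longrightarrow> j < k \<longrightarrow> k < length xs \<longrightarrow> \<not> (xs ! i < xs ! j \<and> xs ! k < xs ! j)"
  \<comment> \<open>Since \<open>j\<close> and \<open>k\<close> exceed \<open>i\<close>, they are
    positive; only \<open>i\<close> can point at the head.\<close>
  have "(\<forall>i j k. ?P (x # xs) i j k) \<longleftrightarrow>
      (\<forall>j k. ?P (x # xs) 0 (Suc j) (Suc k)) \<and> (\<forall>i j k. ?P (x # xs) (Suc i) (Suc j) (Suc k))"
    (is "?L \<longleftrightarrow> ?R")
  proof
    assume R: ?R
    show ?L
    proof (intro allI)
      fix i j k
      show "?P (x # xs) i j k"
        using R by (cases i; cases j; cases k) auto
    qed
  qed blast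
  then show ?case
    using Cons.IH by (auto simp: sorted_wrt_iff_nth_less)
qed simp

lemma contains_pattern_three:
  "contains_pattern \<tau> [p, q, r] \<longleftrightarrow>
     (\<exists>i j k. i < j \<and> j < k \<and> k < length \<tau> \<and> (\<tau> ! i < \<tau> ! j \<longleftrightarrow> p < q) \<and>
        (\<tau> ! i < \<tau> ! k \<longleftrightarrow> p < r) \<and> (\<tau> ! j < \<tau> ! k \<longleftrightarrow> q < r))"
  (is "?L \<longleftrightarrow> ?R")
proof
  assume ?L
  then obtain f where f: "strict_mono_on {..<3} f" "\<forall>a<3. f a < length \<tau>"
      "\<forall>a b. a < b \<and> b < 3 \<longrightarrow> (\<tau> ! f a < \<tau> ! f b \<longleftrightarrow> [p, q, r] ! a < [p, q, r] ! b)"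
    by (auto simp: contains_pattern_def numeral_3_eq_3)
  have "f 0 < f 1" "f 1 < f 2"
    using f(1) by (auto simp: strict_mono_on_def)
  moreover have "f 2 < length \<tau>"
    using f(2) by simp
  ultimately show ?R
    using f(3)[rule_format, of 0 1] f(3)[rule_format, of 0 2] f(3)[rule_format, of 1 2]
    by (intro exI[of _ "f 0"] exI[of _ "f 1"] exI[of _ "f 2"]) simp
next
  assume ?R
  then obtain i j k where ijk: "i < j" "j < k" "k < length \<tau>" "\<tau> ! i < \<tau> ! j \<longleftrightarrow> p < q"
      "\<tau> ! i < \<tau> ! k \<longleftrightarrow> p < r" "\<tau> ! j < \<tau> ! k \<longleftrightarrow> q < r"
    by blast
  have less3: "a < Suc (Suc (Suc 0)) \<longleftrightarrow> a = 0 \<or> a = 1 \<or> a = 2" for a :: nat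
    by auto
  show ?L
    unfolding contains_pattern_def
    using ijk
    \<comment> \<open>List lookup serves as the index function; its values beyond 2 do not
      matter.\<close>
    by (intro exI[of _ "(!) [i, j, k]"])
       (auto simp: strict_mono_on_def less3 less_2_cases_iff)
qed

text \<open>The two patterns differ only in how their outer entries compare, so their disjunction
  leaves that comparison free. Distinctness turns the remaining "not less" into "greater".\<close>

lemma valley_iff_avoids_pattern:
  assumes "distinct xs"
  shows "valley xs \<longleftrightarrow> avoids_pattern xs [1, 3, 2] \<and> avoids_pattern xs [2, 3, 1]"
proof -
  have "contains_pattern xs [1, 3, 2] \<or> contains_pattern xs [2, 3, 1] \<longleftrightarrow>
    (\<exists>i j k. i < j \<and> j < k \<and> k < length xs \<and> xs ! i < xs ! j \<and> \<not> xs ! j < xs ! k)"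
    unfolding contains_pattern_three ex_disj_distrib[symmetric] by (intro ex_cong1) auto
  also have "\<dots> \<longleftrightarrow>
    (\<exists>i j k. i < j \<and> j < k \<and> k < length xs \<and> xs ! i < xs ! j \<and> xs ! k < xs ! j)"
  proof -
    have "\<not> xs ! j < xs ! k \<longleftrightarrow> xs ! k < xs ! j" if "j < k" "k < length xs" for j k
      using that assms by (auto simp: not_less le_less nth_eq_iff_index_eq)
    then show ?thesis
      by blast
  qed
  finally show ?thesis
    unfolding valley_iff_nth by blast
qed

text \<open>Induction on \<open>A\<close>, adding a new maximum \<open>b\<close>. The truncated
  exponent also covers the case of no entry below \<open>m\<close>, where only the increasing word
  remains.\<close>

lemma card_valley_Cons_permutations:
  fixes m :: "'a::linorder"
  assumes "finite A" and "m \<notin> A"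
  shows "card {w \<in> permutations_of_set A. valley (m # w)} = 2 ^ (card {a \<in> A. a < m} - 1)"
  using assms
proof (induction rule: finite_linorder_max_induct)
  case empty
  have "{w \<in> permutations_of_set {}. valley (m # w)} = {[]}"
    by auto
  then show ?case
    by simp
next
  case (insert b A)
  let ?P = "\<lambda>A. {w \<in> permutations_of_set A. valley (m # w)}"
  have b: "b \<notin> A" "b \<noteq> m" and less_b: "\<And>a. a \<in> A \<Longrightarrow> a < b"
    using insert by auto
  have IH: "card (?P A) = 2 ^ (card {a \<in> A. a < m} - 1)"
    using insert by auto
  have fin: "finite (?P A)"
    by simp
  show ?case
  proof (cases "A = {}")
    case True
    have "?P {b} = {[b]}"
      by auto
    \<comment> \<open>With a single entry the two ends coincide, and the exponent is 0 whether or
      not \<open>b < m\<close>.\<close>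
    moreover have "card {a \<in> {b}. a < m} \<le> card {b}"
      by (rule card_mono) auto
    ultimately show ?thesis
      using True by simp
  next
    case nonempty: False
    \<comment> \<open>Being the maximum, \<open>b\<close> is never a low outer entry of a forbidden
      triple.\<close>
    have below_b: "sorted_wrt (\<lambda>a a'. \<not> (b < a \<and> a' < a)) w"
        "sorted_wrt (\<lambda>a a'. \<not> (a < a' \<and> b < a')) w" if "set w = A" for w
    proof -
      have "\<not> b < w ! i" if "i < length w" for i
        using less_b[of "w ! i"] nth_mem[OF that] \<open>set w = A\<close> less_asym by blast
      then show "sorted_wrt (\<lambda>a a'. \<not> (b < a \<and> a' < a)) w"
          "sorted_wrt (\<lambda>a a'. \<not> (a < a' \<and> b < a')) w"
        by (auto simp: sorted_wrt_iff_nth_less)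
    qed
    have snoc: "w @ [b] \<in> ?P (insert b A)" if "w \<in> ?P A" for w
      using that b less_b below_b
      by (auto simp: permutations_of_set_def valley_append sorted_wrt_append dest: less_asym)
    have cons: "b # w \<in> ?P (insert b A)" if "w \<in> ?P A" "b < m" for w
      using that b less_b below_b
      by (auto simp: permutations_of_set_def dest: less_asym)
    have ends: "(\<exists>v\<in>?P A. w = v @ [b]) \<or> b < m \<and> (\<exists>v\<in>?P A. w = b # v)"
      if w: "w \<in> ?P (insert b A)" for w
    proof -
      have "b \<in> set w"
        using w by (auto simp: permutations_of_set_def)
      then obtain xs ys where split: "w = xs @ b # ys"
        by (meson split_list)
      have sets: "set xs \<union> set ys = A" "distinct xs" "distinct ys" "set xs \<inter> set ys = {}"
        using w b by (auto simp: split permutations_of_set_def)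
      have v: "valley (m # xs @ b # ys)"
        using w by (simp add: split)
      \<comment> \<open>Entries on both sides would make \<open>b\<close> a peak.\<close>
      have "xs = [] \<or> ys = []"
      proof (rule ccontr)
        assume "\<not> ?thesis"
        then obtain x y where "x \<in> set xs" "y \<in> set ys"
          by (meson list.set_sel(1))
        then show False
          using v less_b[of x] less_b[of y] sets(1) by (auto simp: valley_append)
      qed
      then show ?thesis
      proof
        assume "ys = []"
        then show ?thesis
          using v sets by (auto simp: split permutations_of_set_def valley_append sorted_wrt_append)
      next
        \<comment> \<open>Here \<open>m\<close>, \<open>b\<close>, \<open>y\<close> occur in this
          order with \<open>y < b\<close>, so \<open>m < b\<close> is impossible.\<close>
        assume "xs = []"
        moreover from this obtain y where "y \<in> set ys"
          using nonempty sets(1) by (cases ys) auto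
        ultimately have "b < m"
          using v less_b[of y] sets(1) b(2) by auto
        with \<open>xs = []\<close> show ?thesis
          using v sets by (auto simp: split permutations_of_set_def)
      qed
    qed
    show ?thesis
    proof (cases "b < m")
      case True
      have "?P (insert b A) = (\<lambda>w. w @ [b]) ` ?P A \<union> Cons b ` ?P A"
        using snoc cons[OF _ True] ends by blast
      moreover have "(\<lambda>w. w @ [b]) ` ?P A \<inter> Cons b ` ?P A = {}"
      proof -
        \<comment> \<open>Otherwise the nonempty \<open>w\<close> would start with \<open>b\<close>,
          which is not in \<open>A\<close>.\<close>
        have "w @ [b] \<noteq> b # v" if "w \<in> ?P A" for v w
          using that b nonempty by (cases w) (auto simp: permutations_of_set_def)
        then show ?thesis
          by blast
      qed
      ultimately have "card (?P (insert b A)) = 2 * card (?P A)"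
        using fin by (simp add: card_Un_disjoint card_image inj_on_def del: valley.simps)
      moreover have "{a \<in> A. a < m} = A" "{a \<in> insert b A. a < m} = insert b A"
        using True less_b less_trans by blast+
      \<comment> \<open>This makes the truncated exponent grow by exactly one.\<close>
      moreover have "card A > 0"
        using nonempty insert.hyps by (simp add: card_gt_0_iff)
      ultimately show ?thesis
        using IH b(1) insert.hyps nonempty by (simp add: power_eq_if del: valley.simps)
    next
      case False
      have "?P (insert b A) = (\<lambda>w. w @ [b]) ` ?P A"
        using snoc ends False by blast
      moreover have "{a \<in> insert b A. a < m} = {a \<in> A. a < m}"
        using False by auto
      ultimately show ?thesis
        using IH by (simp add: card_image inj_on_def del: valley.simps)
    qed
  qed
qed

text \<open>A smaller left end forbids more, so the condition for the minimum implies all the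
  others.\<close>

lemma sorted_wrt_above_Min:
  assumes "finite C" and "C \<noteq> {}"
  shows "(\<forall>x\<in>C. sorted_wrt (\<lambda>a b. \<not> (x < a \<and> b < a)) w) \<longleftrightarrow>
     sorted_wrt (\<lambda>a b. \<not> (Min C < a \<and> b < a)) w"
  using assms by (auto simp: sorted_wrt_iff_nth_less Min_less_iff)

theorem theorem5p7:
  fixes n t :: nat and c :: "nat list"
  assumes "n \<ge> 3" and "1 \<le> t" and "t < n"
    and "length c = t" and "set c \<subseteq> {1..n}" and "distinct c"
    and "avoids_pattern c [1, 3, 2]" and "avoids_pattern c [2, 3, 1]"
  shows "if \<exists>\<alpha> \<in> {1..n} - set c. \<exists>i j. i < j \<and> j < t \<and>
              ((c ! i < \<alpha> \<and> \<alpha> < c ! j) \<or> (\<alpha> < c ! i \<and> c ! i < c ! j))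
         then card (avoiding_perms_with_prefix n c {[1, 3, 2], [2, 3, 1]}) = 0
         else card (avoiding_perms_with_prefix n c {[1, 3, 2], [2, 3, 1]})
                = 2 ^ nat (max 0 (int (Min (set c)) - 2))"
proof -
  let ?A = "{1..n} - set c" and ?m = "Min (set c)"
  let ?T = "avoiding_perms_with_prefix n c {[1, 3, 2], [2, 3, 1]}"
  \<comment> \<open>No missing value may complete a forbidden triple whose first two entries lie in
    \<open>c\<close>.\<close>
  let ?compat = "\<forall>y\<in>?A. sorted_wrt (\<lambda>a b. \<not> (a < b \<and> y < b)) c"
  have "c \<noteq> []"
    using assms by auto
  then have m: "?m \<in> set c"
    by simp
  have valley_c: "valley c"
    using assms by (simp add: valley_iff_avoids_pattern)
  have "?T = {\<tau> \<in> permutations_of_set {1..n}. take (length c) \<tau> = c \<and> valley \<tau>}"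
    unfolding avoiding_perms_with_prefix_def
    by (intro Collect_cong) (auto simp: valley_iff_avoids_pattern permutations_of_set_def)
  also have "\<dots> = (@) c ` {w \<in> permutations_of_set ?A. valley (c @ w)}" (is "?S = ?R")
  proof (intro set_eqI iffI)
    fix \<tau> assume \<tau>: "\<tau> \<in> ?S"
    then obtain w where "\<tau> = c @ w"
      by (metis (mono_tags, lifting) append_take_drop_id mem_Collect_eq)
    moreover from this have "w \<in> permutations_of_set ?A"
      using \<tau> by (auto simp: permutations_of_set_def)
    ultimately show "\<tau> \<in> ?R"
      using \<tau> by blast
  next
    fix \<tau> assume "\<tau> \<in> ?R"
    then obtain w where "\<tau> = c @ w" "w \<in> permutations_of_set ?A" "valley (c @ w)"
      by blast
    moreover have "set c \<union> ?A = {1..n}"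
      using assms(5) by blast
    ultimately show "\<tau> \<in> ?S"
      using assms(6) by (simp add: permutations_of_set_def)
  qed
  finally have T: "?T = (@) c ` {w \<in> permutations_of_set ?A. valley (c @ w)}" .
  have bad_iff: "(\<exists>\<alpha> \<in> ?A. \<exists>i j. i < j \<and> j < t \<and>
      ((c ! i < \<alpha> \<and> \<alpha> < c ! j) \<or> (\<alpha> < c ! i \<and> c ! i < c ! j))) \<longleftrightarrow> \<not> ?compat"
  proof -
    \<comment> \<open>The two alternatives merely separate \<open>\<alpha>\<close> above
      \<open>c ! i\<close> from \<open>\<alpha>\<close> below it; equality is excluded.\<close>
    have "(c ! i < \<alpha> \<and> \<alpha> < c ! j) \<or> (\<alpha> < c ! i \<and> c ! i < c ! j) \<longleftrightarrow> c ! i < c ! j \<and> \<alpha> < c ! j"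
      if "\<alpha> \<in> ?A" "i < j" "j < t" for \<alpha> i j
    proof -
      have "c ! i \<noteq> \<alpha>"
        using that assms(4) by auto
      then show ?thesis
        by linarith
    qed
    then show ?thesis
      unfolding sorted_wrt_iff_nth_less assms(4) by blast
  qed
  show ?thesis
  proof (cases ?compat)
    case False
    \<comment> \<open>Every completion contains all missing values, including an offending
      one.\<close>
    have "?T = {}"
      using False unfolding T by (auto simp: valley_append permutations_of_set_def)
    then show ?thesis
      using False by (simp only: bad_iff) simp
  next
    case True
    \<comment> \<open>Of the conditions in \<open>valley_append\<close>, only
      \<open>valley w\<close> and those with left end in \<open>c\<close> remain open; the latter
      reduce to left end \<open>?m\<close>.\<close>
    have "{w \<in> permutations_of_set ?A. valley (c @ w)} =
        {w \<in> permutations_of_set ?A. valley (?m # w)}"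
      using True valley_c \<open>c \<noteq> []\<close> sorted_wrt_above_Min[of "set c"]
      by (auto simp: valley_append permutations_of_set_def)
    then have "card ?T = card {w \<in> permutations_of_set ?A. valley (?m # w)}"
      unfolding T by (simp add: card_image inj_on_def del: valley.simps)
    also have "\<dots> = 2 ^ (card {a \<in> ?A. a < ?m} - 1)"
      using m by (intro card_valley_Cons_permutations) auto
    \<comment> \<open>All values below the minimum are missing from \<open>c\<close>, so there are
      \<open>?m - 1\<close> of them and the exponent is \<open>?m - 2\<close>, truncated at
      0.\<close>
    also have "{a \<in> ?A. a < ?m} = {1..<?m}"
    proof -
      have "?m \<le> n"
        using m assms(5) by auto
      then show ?thesis
        using \<open>c \<noteq> []\<close> by (auto simp: not_le[symmetric])
    qed
    finally have "card ?T = 2 ^ (?m - 2)"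
      by (simp add: numeral_2_eq_2)
    moreover have "nat (max 0 (int ?m - 2)) = ?m - 2"
      by simp
    ultimately show ?thesis
      using True by (simp only: bad_iff) simp
  qed
qed

end
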